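(* Consider a sporadic task system with arbitrary deadlines scheduled on one processor by a preemptive fixed-priority scheduling algorithm. Let $\tau_k$ be a task with $C_k>0$, let $hp(\tau_k)$ be the set of tasks with higher priority than $\tau_k$, and assume that these tasks are schedulable. Let $hp_1(\tau_k)=\{\tau_i\in hp(\tau_k): T_i<D_k\}$, $hp_2(\tau_k)=\{\tau_i\in hp(\tau_k):T_i\ge D_k\}$, suppose that there are $k-1$ tasks in $hp_1(\tau_k)$, and let $$C_k'=\left\lceil\frac{D_k}{T_k}\right\rceil C_k+\sum_{\tau_i\in hp_2(\tau_k)}C_i .$$ Then $\tau_k$ is schedulable by the fixed-priority scheduling algorithm if $$\left(\frac{C_k'}{D_k}+1\right)\prod_{\tau_j\in hp_1(\tau_k)}(U_j+1)\le 2$$ or $$\frac{C_k'}{D_k}+\sum_{\tau_j\in hp_1(\tau_k)}U_j\le k\left(2^{\frac1k}-1\right).$$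
   Context: A sporadic task $\tau_i$ has (worst-case) execution time $C_i>0$ per job, minimum inter-arrival time (period) $T_i$ and relative deadline $D_i$; it releases a sequence of jobs with consecutive releases at least $T_i$ apart, a job released at $r$ has absolute deadline $r+D_i$, and jobs of the same task execute in sequence (in release order). Utilization: $U_i=C_i/T_i$. Arbitrary deadlines: no relation between $D_i$ and $T_i$ is imposed. Preemptive fixed-priority scheduling on one processor: each task has a priority level, and at any time the ready job of highest priority is executed. A task is schedulable if all of its jobs always finish by their absolute deadlines. *)

theory Defs
  imports "HOL-Analysis.Analysis" "HOL-Library.Extended_Nat"
begin

text \<open>A larger value of \<open>prio\<close> is a higher priority. Priority levels are not required to be
  distinct here.\<close>

record 'a task_system =
  tasks :: "'a set"
  wcet :: "'a \<Rightarrow> real"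
  period :: "'a \<Rightarrow> real"
  rel_deadline :: "'a \<Rightarrow> real"
  prio :: "'a \<Rightarrow> nat"

definition sporadic_task_system :: "'a task_system \<Rightarrow> bool" where
  "sporadic_task_system S \<longleftrightarrow> finite (tasks S) \<and>
     (\<forall>i\<in>tasks S. wcet S i > 0 \<and> period S i > 0 \<and> rel_deadline S i > 0)"

definition utilization :: "'a task_system \<Rightarrow> 'a \<Rightarrow> real" where
  "utilization S i = wcet S i / period S i"

text \<open>A run-time behaviour of the tasks: task \<open>i\<close> releases the jobs \<open>(i, n)\<close> with
  \<open>n < num_jobs A i\<close> (possibly infinitely many); \<open>exec_time\<close> is the actual execution
  requirement of a job, bounded by the worst case. The system starts at time 0.\<close>

record 'a arrivals =
  num_jobs :: "'a \<Rightarrow> enat"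
  release :: "'a \<Rightarrow> nat \<Rightarrow> real"
  exec_time :: "'a \<Rightarrow> nat \<Rightarrow> real"

definition legal_arrivals :: "'a task_system \<Rightarrow> 'a arrivals \<Rightarrow> bool" where
  "legal_arrivals S A \<longleftrightarrow>
     (\<forall>i\<in>tasks S. \<forall>n. enat n < num_jobs A i \<longrightarrow>
        0 \<le> release A i n \<and> 0 < exec_time A i n \<and> exec_time A i n \<le> wcet S i \<and>
        (enat (Suc n) < num_jobs A i \<longrightarrow> release A i n + period S i \<le> release A i (Suc n)))"

text \<open>A uniprocessor schedule maps each instant to the job executed then, \<open>None\<close> being idle.\<close>

type_synonym 'a schedule = "real \<Rightarrow> ('a \<times> nat) option"

definition service :: "'a schedule \<Rightarrow> 'a \<Rightarrow> nat \<Rightarrow> real \<Rightarrow> real" where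
  "service \<sigma> i n t = measure lebesgue {s \<in> {0..<t}. \<sigma> s = Some (i, n)}"

definition finished :: "'a arrivals \<Rightarrow> 'a schedule \<Rightarrow> 'a \<Rightarrow> nat \<Rightarrow> real \<Rightarrow> bool" where
  "finished A \<sigma> i n t \<longleftrightarrow> exec_time A i n \<le> service \<sigma> i n t"

text \<open>The last conjunct expresses that jobs of the same task execute in release order.\<close>

definition ready ::
  "'a task_system \<Rightarrow> 'a arrivals \<Rightarrow> 'a schedule \<Rightarrow> 'a \<Rightarrow> nat \<Rightarrow> real \<Rightarrow> bool" where
  "ready S A \<sigma> i n t \<longleftrightarrow> i \<in> tasks S \<and> enat n < num_jobs A i \<and> release A i n \<le> t \<and>
     \<not> finished A \<sigma> i n t \<and> (\<forall>m<n. finished A \<sigma> i m t)"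

text \<open>Preemptive and work-conserving: the condition is imposed at every instant. Ties between
  tasks of equal priority level may be resolved arbitrarily. Measurability makes the service
  received by a job meaningful.\<close>

definition fp_schedule :: "'a task_system \<Rightarrow> 'a arrivals \<Rightarrow> 'a schedule \<Rightarrow> bool" where
  "fp_schedule S A \<sigma> \<longleftrightarrow>
     (\<forall>j. {s. \<sigma> s = Some j} \<in> sets lebesgue) \<and>
     (\<forall>t. case \<sigma> t of
        None \<Rightarrow> (\<forall>i n. \<not> ready S A \<sigma> i n t)
      | Some (i, n) \<Rightarrow> ready S A \<sigma> i n t \<and>
          (\<forall>i' n'. ready S A \<sigma> i' n' t \<longrightarrow> prio S i' \<le> prio S i))"

definition schedulable :: "'a task_system \<Rightarrow> 'a \<Rightarrow> bool" where
  "schedulable S i \<longleftrightarrow>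
     (\<forall>A \<sigma>. legal_arrivals S A \<longrightarrow> fp_schedule S A \<sigma> \<longrightarrow>
        (\<forall>n. enat n < num_jobs A i \<longrightarrow>
           finished A \<sigma> i n (release A i n + rel_deadline S i)))"

definition hp :: "'a task_system \<Rightarrow> 'a \<Rightarrow> 'a set" where
  "hp S k = {i \<in> tasks S. prio S i > prio S k}"

definition hp1 :: "'a task_system \<Rightarrow> 'a \<Rightarrow> 'a set" where
  "hp1 S k = {i \<in> hp S k. period S i < rel_deadline S k}"

definition hp2 :: "'a task_system \<Rightarrow> 'a \<Rightarrow> 'a set" where
  "hp2 S k = {i \<in> hp S k. period S i \<ge> rel_deadline S k}"

definition wcet' :: "'a task_system \<Rightarrow> 'a \<Rightarrow> real" where
  "wcet' S k = of_int \<lceil>rel_deadline S k / period S k\<rceil> * wcet S k + (\<Sum>i\<in>hp2 S k. wcet S i)"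

end

theory Submission
  imports Defs
begin

text \<open>
  Let \<open>t\<^sub>i\<close> be the largest multiple of \<open>T\<^sub>i\<close> below \<open>D\<^sub>k\<close> for the tasks of \<open>hp\<^sub>1\<close>. If the demand
  \<open>C\<^sub>k' + \<Sum>\<lceil>t/T\<^sub>i\<rceil> C\<^sub>i\<close> exceeded \<open>t\<close> at every \<open>t \<in> {t\<^sub>i} \<union> {D\<^sub>k}\<close>, then adding the tasks in the
  order of the \<open>t\<^sub>i\<close> would multiply the demand by at most \<open>U\<^sub>i + 1\<close> at each step, which contradicts
  the product bound; the sum bound implies the product bound by the AM-GM inequality. So the
  demand is met at some \<open>t \<le> D\<^sub>k\<close>. Consequently no busy interval of the tasks of priority at least
  that of \<open>\<tau>\<^sub>k\<close> is longer than \<open>t\<close>, so that each job of \<open>\<tau>\<^sub>k\<close> finishes within \<open>D\<^sub>k\<close> of its release.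
\<close>

section \<open>The utilization bounds\<close>

lemma prod_le_mean_power:
  fixes x :: "'b \<Rightarrow> real"
  assumes "finite I" "I \<noteq> {}" "\<And>i. i \<in> I \<Longrightarrow> 0 \<le> x i"
  shows "(\<Prod>i\<in>I. x i) \<le> ((\<Sum>i\<in>I. x i) / card I) ^ card I"
proof -
  have pos: "card I > 0" using assms by (simp add: card_gt_0_iff)
  have nn: "0 \<le> (\<Prod>i\<in>I. x i)" using assms(3) by (rule prod_nonneg)
  have "(\<Prod>i\<in>I. x i) = ((\<Prod>i\<in>I. x i) powr (1 / card I)) ^ card I"
    using pos nn by (cases "(\<Prod>i\<in>I. x i) = 0") (simp_all add: powr_power)
  also have "\<dots> \<le> ((\<Sum>i\<in>I. x i / card I)) ^ card I"
    using arith_geom_mean[OF assms] pos nn by (intro power_mono) auto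
  finally show ?thesis by (simp add: sum_divide_distrib)
qed

text \<open>The AM-GM inequality for the \<open>k\<close> numbers \<open>c + 1\<close> and
  \<open>u i + 1\<close>: their mean exceeds \<open>(c + (\<Sum>i\<in>I. u i)) / k\<close> by
  exactly 1, so the bound says that the mean is at most the \<open>k\<close>-th root of 2.\<close>

lemma sum_bound_imp_product_bound:
  fixes c :: real and u :: "'b \<Rightarrow> real"
  assumes "finite I" "card I = k - 1" "k \<ge> 1" "c \<ge> 0" "\<And>i. i \<in> I \<Longrightarrow> 0 \<le> u i"
    and bound: "c + (\<Sum>i\<in>I. u i) \<le> real k * (2 powr (1 / real k) - 1)"
  shows "(c + 1) * (\<Prod>i\<in>I. u i + 1) \<le> 2"
proof -
  \<comment> \<open>The option type supplies one index besides those of \<open>I\<close>: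
    \<open>None\<close> carries the factor \<open>c + 1\<close>.\<close>
  define x where "x = (\<lambda>j. case j of None \<Rightarrow> c + 1 | Some i \<Rightarrow> u i + 1)"
  define J where "J = insert None (Some ` I)"
  have fin: "finite J" and card: "card J = k"
    using assms(1-3) by (auto simp: J_def card_image)
  have sum: "(\<Sum>j\<in>J. x j) = c + (\<Sum>i\<in>I. u i) + k"
    using assms(1-3) by (simp add: J_def x_def sum.reindex sum.distrib of_nat_diff)
  have "(c + 1) * (\<Prod>i\<in>I. u i + 1) = (\<Prod>j\<in>J. x j)"
    using assms(1) by (simp add: J_def x_def prod.reindex)
  also have "\<dots> \<le> ((\<Sum>j\<in>J. x j) / k) ^ k"
  proof -
    have "0 \<le> x j" if "j \<in> J" for j using that assms(4,5) by (auto simp: J_def x_def)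
    moreover have "J \<noteq> {}" by (simp add: J_def)
    ultimately show ?thesis using prod_le_mean_power[OF fin, of x] by (simp add: card)
  qed
  also have "\<dots> \<le> (2 powr (1 / k)) ^ k"
  proof (rule power_mono)
    show "(\<Sum>j\<in>J. x j) / k \<le> 2 powr (1 / k)"
      using bound assms(3) by (simp add: sum field_simps)
    show "0 \<le> (\<Sum>j\<in>J. x j) / k"
      using assms(4,5) by (auto simp: sum intro!: divide_nonneg_nonneg add_nonneg_nonneg sum_nonneg)
  qed
  also have "\<dots> = 2"
    using assms(3) by (simp add: powr_power)
  finally show ?thesis .
qed

text \<open>Add the indices in increasing order of \<open>t\<close>. The newest \<open>t x\<close>
  is at most the sum accumulated so far, so the new term \<open>t x * u x\<close> multiplies that
  sum by at most \<open>u x + 1\<close>.\<close>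

lemma accumulated_demand_le_product:
  fixes a :: real and t u :: "'b \<Rightarrow> real"
  assumes "finite I" "\<And>i. i \<in> I \<Longrightarrow> 0 \<le> t i" "\<And>i. i \<in> I \<Longrightarrow> 0 \<le> u i"
    and "\<And>i. i \<in> I \<Longrightarrow> t i \<le> a + (\<Sum>j\<in>{j\<in>I. t j < t i}. t j * u j)"
  shows "a + (\<Sum>i\<in>I. t i * u i) \<le> a * (\<Prod>i\<in>I. u i + 1)"
  using assms
proof (induction rule: finite_ranking_induct[where f = t])
  case empty
  then show ?case by simp
next
  case (insert x I)
  show ?case
  \<comment> \<open>The ranking induction does not guarantee that the inserted element is
    new.\<close>
  proof (cases "x \<in> I")
    case True
    then show ?thesis using insert by (simp add: insert_absorb)
  next
    case False
    have IH: "a + (\<Sum>i\<in>I. t i * u i) \<le> a * (\<Prod>i\<in>I. u i + 1)"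
    proof (rule insert.IH)
      fix i assume i: "i \<in> I"
      \<comment> \<open>As \<open>t x\<close> is maximal, \<open>x\<close> enters no sum that
        belongs to an earlier index.\<close>
      have "{j \<in> insert x I. t j < t i} = {j \<in> I. t j < t i}"
        using insert.hyps(2)[OF i] by auto
      then show "t i \<le> a + (\<Sum>j\<in>{j\<in>I. t j < t i}. t j * u j)"
        using insert.prems(3)[of i] i by simp
    qed (use insert.prems in auto)
    have "t x \<le> a + (\<Sum>j\<in>{j\<in>insert x I. t j < t x}. t j * u j)"
      using insert.prems(3) by blast
    also have "\<dots> \<le> a + (\<Sum>j\<in>I. t j * u j)"
      using insert.hyps insert.prems(1,2) by (intro add_left_mono sum_mono2) auto
    finally have "t x * u x \<le> (a + (\<Sum>j\<in>I. t j * u j)) * u x"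
      using insert.prems(2) by (intro mult_right_mono) auto
    then have "a + (\<Sum>i\<in>insert x I. t i * u i) \<le> (a + (\<Sum>j\<in>I. t j * u j)) * (u x + 1)"
      using False insert.hyps(1) by (simp add: algebra_simps)
    also have "\<dots> \<le> (a * (\<Prod>i\<in>I. u i + 1)) * (u x + 1)"
      using IH insert.prems(2)[of x] by (intro mult_right_mono) auto
    finally show ?thesis
      using False insert.hyps(1) by (simp add: algebra_simps)
  qed
qed

lemma product_bound_imp_demand_met:
  fixes c D :: real and C T :: "'b \<Rightarrow> real"
  assumes fin: "finite I" and c: "c > 0" and D: "D > 0"
    and C: "\<And>i. i \<in> I \<Longrightarrow> C i > 0" and T: "\<And>i. i \<in> I \<Longrightarrow> 0 < T i \<and> T i < D"
    and bound: "(c / D + 1) * (\<Prod>i\<in>I. C i / T i + 1) \<le> 2"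
  shows "\<exists>s. 0 < s \<and> s \<le> D \<and> c + (\<Sum>i\<in>I. of_int \<lceil>s / T i\<rceil> * C i) \<le> s"
proof (rule ccontr)
  assume "\<not> ?thesis"
  then have unmet: "s < c + (\<Sum>i\<in>I. of_int \<lceil>s / T i\<rceil> * C i)" if "0 < s" "s \<le> D" for s
    using that by force
  define u where "u = (\<lambda>i. C i / T i)"
  define t where "t = (\<lambda>i. of_int (\<lceil>D / T i\<rceil> - 1) * T i)"
  have u: "0 < u i" if "i \<in> I" for i using C T that by (simp add: u_def)
  have t: "0 < t i" "t i < D" if "i \<in> I" for i
  proof -
    have "1 < D / T i" using T[OF that] by simp
    then have "1 < \<lceil>D / T i\<rceil>" by linarith
    then show "0 < t i" using T[OF that] by (simp add: t_def)
    have "of_int (\<lceil>D / T i\<rceil> - 1) < D / T i" by linarith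
    then show "t i < D" using T[OF that] unfolding t_def by (simp add: pos_less_divide_eq)
  qed
  \<comment> \<open>Each task is charged \<open>t i * u i\<close> once up to time \<open>t i\<close>
    and twice afterwards. Past \<open>t i\<close> only one more job is released before
    \<open>D\<close>, and its cost \<open>C i\<close> is at most \<open>t i * u i\<close>.\<close>
  have demand: "(\<Sum>i\<in>I. of_int \<lceil>s / T i\<rceil> * C i) \<le>
      (\<Sum>i\<in>I. t i * u i) + (\<Sum>i\<in>{i\<in>I. t i < s}. t i * u i)" if "s \<le> D" for s
  proof -
    have "of_int \<lceil>s / T i\<rceil> * C i \<le> t i * u i + (if t i < s then t i * u i else 0)"
      if i: "i \<in> I" for i
    proof -
      have tu: "t i * u i = of_int (\<lceil>D / T i\<rceil> - 1) * C i"
        using T[OF i] by (simp add: t_def u_def)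
      \<comment> \<open>Since \<open>T i < D\<close>, the ceiling is at least 2; hence it is at most
        twice its predecessor, which permits the second charge.\<close>
      have ge1: "1 \<le> \<lceil>D / T i\<rceil> - 1"
        using T[OF i] by (simp add: less_ceiling_iff le_diff_eq flip: zless_imp_add1_zle)
      show ?thesis
      proof (cases "t i < s")
        case True
        have "\<lceil>s / T i\<rceil> \<le> \<lceil>D / T i\<rceil>"
          using \<open>s \<le> D\<close> T[OF i] by (intro ceiling_mono divide_right_mono) auto
        also have "\<dots> \<le> (\<lceil>D / T i\<rceil> - 1) + (\<lceil>D / T i\<rceil> - 1)" using ge1 by linarith
        finally have "of_int \<lceil>s / T i\<rceil> * C i \<le> of_int ((\<lceil>D / T i\<rceil> - 1) + (\<lceil>D / T i\<rceil> - 1)) * C i"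
          using C[OF i] by (intro mult_right_mono) auto
        also have "\<dots> = t i * u i + t i * u i"
          unfolding tu by (simp only: of_int_add distrib_right)
        finally show ?thesis using True by simp
      next
        case False
        \<comment> \<open>At \<open>s = t i\<close> the quotient is the integer itself, so the jump
          occurs strictly after \<open>t i\<close>; this is why the case split is on
          \<open>t i < s\<close>.\<close>
        then have "s / T i \<le> of_int (\<lceil>D / T i\<rceil> - 1)"
          using T[OF i] unfolding t_def by (simp add: pos_divide_le_eq)
        then have "\<lceil>s / T i\<rceil> \<le> \<lceil>D / T i\<rceil> - 1" by (simp only: ceiling_le_iff)
        then have "of_int \<lceil>s / T i\<rceil> * C i \<le> of_int (\<lceil>D / T i\<rceil> - 1) * C i"
          using C[OF i] by (intro mult_right_mono) (auto simp only: of_int_le_iff)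
        then show ?thesis using False tu by simp
      qed
    qed
    then have "(\<Sum>i\<in>I. of_int \<lceil>s / T i\<rceil> * C i) \<le>
        (\<Sum>i\<in>I. t i * u i + (if t i < s then t i * u i else 0))"
      by (rule sum_mono)
    then show ?thesis using fin by (simp add: sum.distrib sum.inter_filter)
  qed
  define w where "w = (\<Sum>i\<in>I. t i * u i)"
  define P where "P = (\<Prod>i\<in>I. u i + 1)"
  \<comment> \<open>The first charges of all tasks join the constant \<open>c\<close>, giving the
    initial value \<open>c + w\<close>; the second charges are then accumulated in the order of the
    \<open>t i\<close>.\<close>
  have chain: "(c + w) + w \<le> (c + w) * P"
    unfolding P_def w_def
  proof (rule accumulated_demand_le_product[OF fin])
    fix i assume i: "i \<in> I"
    show "t i \<le> c + (\<Sum>i\<in>I. t i * u i) + (\<Sum>j\<in>{j\<in>I. t j < t i}. t j * u j)"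
      using unmet[of "t i"] demand[of "t i"] t[OF i] by simp
  qed (use t u in \<open>auto intro: less_imp_le\<close>)
  have "{i \<in> I. t i < D} = I" using t by auto
  then have exceeds: "D < c + 2 * w"
    using unmet[of D] demand[of D] D by (simp add: w_def)
  have "(c + D) * P \<le> 2 * D"
    using bound D unfolding P_def u_def by (simp add: field_simps)
  moreover have w: "0 \<le> w"
    unfolding w_def using t u by (intro sum_nonneg) (simp add: less_imp_le)
  \<comment> \<open>The factor \<open>P\<close> is eliminated between
    \<open>(c + D) * P \<le> 2 * D\<close> and \<open>chain\<close>. What remains is
    \<open>c + 2 * w \<le> D\<close>, the opposite of \<open>exceeds\<close>.\<close>
  ultimately have "(c + D) * P * (c + w) \<le> 2 * D * (c + w)"
    using c by (intro mult_right_mono) auto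
  moreover have "(c + D) * (c + 2 * w) \<le> (c + D) * ((c + w) * P)"
    using chain c D by (intro mult_left_mono) auto
  ultimately have "c * (c + 2 * w) \<le> c * D"
    by (simp add: algebra_simps)
  then show False using exceeds c by simp
qed

section \<open>Busy intervals\<close>

lemma separated_points_count:
  fixes r :: "nat \<Rightarrow> real"
  assumes T: "T > 0"
    and sep: "\<And>m n. m \<in> N \<Longrightarrow> n \<in> N \<Longrightarrow> m \<le> n \<Longrightarrow> r m + real (n - m) * T \<le> r n"
    and range: "\<And>n. n \<in> N \<Longrightarrow> a \<le> r n \<and> r n < a + s"
    and s: "s > 0"
  shows "finite N" "real (card N) \<le> of_int \<lceil>s / T\<rceil>"
proof -
  define l where "l = (LEAST n. n \<in> N)"
  \<comment> \<open>Counting from the least index \<open>l\<close>, the half-open window makes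
    \<open>n - l\<close> strictly smaller than \<open>s / T\<close>, hence strictly smaller than its
    ceiling.\<close>
  have sub: "N \<subseteq> {l..<l + nat \<lceil>s / T\<rceil>}"
  proof
    fix n assume n: "n \<in> N"
    then have l: "l \<in> N" "l \<le> n" unfolding l_def by (auto intro: LeastI Least_le)
    then have "real (n - l) * T < s" using sep[OF l(1) n l(2)] range[OF n] range[OF l(1)] by simp
    then have "real (n - l) < s / T" using T by (simp add: pos_less_divide_eq)
    then have "int (n - l) < \<lceil>s / T\<rceil>" by (simp add: less_ceiling_iff)
    then show "n \<in> {l..<l + nat \<lceil>s / T\<rceil>}" using l(2) by auto
  qed
  then show "finite N" by (rule finite_subset) simp
  have "card N \<le> nat \<lceil>s / T\<rceil>" using card_mono[OF _ sub] by simp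
  moreover have "0 \<le> \<lceil>s / T\<rceil>" using ceiling_mono[of 0 "s / T"] s T by simp
  ultimately show "real (card N) \<le> of_int \<lceil>s / T\<rceil>" by linarith
qed

lemma lmeasurable_ivl [simp]: "{a..<b::real} \<in> lmeasurable" "{a<..<b::real} \<in> lmeasurable"
  by (auto intro: fmeasurableI2[OF lmeasurable_interval(1)[of a b]])

section \<open>Service, readiness and release distances in a fixed run\<close>

locale fp_run =
  fixes S :: "'a task_system" and A :: "'a arrivals" and \<sigma> :: "'a schedule"
  assumes sys: "sporadic_task_system S"
    and legal: "legal_arrivals S A"
    and fp: "fp_schedule S A \<sigma>"
begin

lemma lmeasurable_executing:
  assumes "X \<in> lmeasurable"
  shows "{s \<in> X. \<sigma> s = Some j} \<in> lmeasurable"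
proof -
  have "{s \<in> X. \<sigma> s = Some j} = X \<inter> {s. \<sigma> s = Some j}" by auto
  moreover have "{s. \<sigma> s = Some j} \<in> sets lebesgue" using fp unfolding fp_schedule_def by blast
  ultimately show ?thesis using assms by (simp add: fmeasurable_Int_fmeasurable)
qed

lemma service_mono: "s \<le> t \<Longrightarrow> service \<sigma> i n s \<le> service \<sigma> i n t"
  unfolding service_def
  by (intro measure_mono_fmeasurable lmeasurable_executing fmeasurableD) auto

lemma finished_mono: "finished A \<sigma> i n s \<Longrightarrow> s \<le> t \<Longrightarrow> finished A \<sigma> i n t"
  unfolding finished_def using service_mono[of s t i n] by linarith

lemma execD:
  assumes "\<sigma> t = Some (i, n)"
  shows "ready S A \<sigma> i n t" "ready S A \<sigma> i' n' t \<Longrightarrow> prio S i' \<le> prio S i"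
proof -
  have "case \<sigma> t of None \<Rightarrow> (\<forall>i n. \<not> ready S A \<sigma> i n t)
      | Some (i, n) \<Rightarrow> ready S A \<sigma> i n t \<and> (\<forall>i' n'. ready S A \<sigma> i' n' t \<longrightarrow> prio S i' \<le> prio S i)"
    using fp unfolding fp_schedule_def by blast
  then show "ready S A \<sigma> i n t" "ready S A \<sigma> i' n' t \<Longrightarrow> prio S i' \<le> prio S i"
    using assms by auto
qed

lemma ready_imp_busy:
  assumes "ready S A \<sigma> i n t"
  obtains i' n' where "\<sigma> t = Some (i', n')" "ready S A \<sigma> i' n' t" "prio S i \<le> prio S i'"
proof (cases "\<sigma> t")
  case None
  then have "\<not> ready S A \<sigma> i n t"
    using fp unfolding fp_schedule_def by (auto dest!: spec[of _ t] split: option.splits)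
  then show ?thesis using assms by simp
next
  case (Some j)
  then show ?thesis using that execD assms by (cases j) blast
qed

text \<open>A job executes only while unfinished. So at an execution instant \<open>s\<close> within
  \<open>e\<close> of the supremum of all such instants before \<open>t\<close>, its service is
  below \<open>exec_time\<close>, and less than \<open>e\<close> can still be added.\<close>

lemma service_le_exec_time:
  assumes "i \<in> tasks S" "enat n < num_jobs A i"
  shows "service \<sigma> i n t \<le> exec_time A i n"
proof -
  define X where "X = {s \<in> {0..<t}. \<sigma> s = Some (i, n)}"
  have pos: "0 < exec_time A i n" using legal assms by (simp add: legal_arrivals_def)
  show ?thesis
  proof (cases "X = {}")
    case True
    then have "service \<sigma> i n t = 0" unfolding service_def X_def[symmetric] by simp
    then show ?thesis using pos by simp
  next
    case False
    have bdd: "bdd_above X" unfolding X_def by (intro bdd_aboveI[of _ t]) auto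
    show ?thesis
    proof (rule field_le_epsilon)
      fix e :: real assume e: "e > 0"
      obtain s where s: "s \<in> X" "Sup X - e < s"
        using less_cSup_iff[OF False bdd, of "Sup X - e"] e by auto
      have "X \<subseteq> {s' \<in> {0..<s}. \<sigma> s' = Some (i, n)} \<union> {s..Sup X}"
        using cSup_upper[OF _ bdd] by (auto simp: X_def)
      then have "measure lebesgue X \<le>
          measure lebesgue ({s' \<in> {0..<s}. \<sigma> s' = Some (i, n)} \<union> {s..Sup X})"
        unfolding X_def
        by (intro measure_mono_fmeasurable fmeasurableD fmeasurable.Un lmeasurable_executing) auto
      also have "\<dots> \<le> service \<sigma> i n s + measure lebesgue {s..Sup X}"
        unfolding service_def
        by (intro measure_Un_le fmeasurableD lmeasurable_executing) auto
      also have "\<dots> \<le> exec_time A i n + e"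
      proof -
        have "\<not> finished A \<sigma> i n s"
          using execD(1)[of s i n] s(1) by (simp add: X_def ready_def)
        then show ?thesis
          using s(2) cSup_upper[OF s(1) bdd] by (simp add: finished_def)
      qed
      finally show "service \<sigma> i n t \<le> exec_time A i n + e"
        by (simp add: service_def X_def)
    qed
  qed
qed

lemma release_separated:
  assumes "i \<in> tasks S" "enat n < num_jobs A i" "m \<le> n"
  shows "release A i m + real (n - m) * period S i \<le> release A i n"
  using assms(3,2)
proof (induction n rule: dec_induct)
  case base
  then show ?case by simp
next
  case (step n)
  have n: "enat n < num_jobs A i" using step.prems by (meson enat_ord_simps(2) lessI less_trans)
  then have "release A i n + period S i \<le> release A i (Suc n)"
    using legal assms(1) step.prems by (simp add: legal_arrivals_def)
  then show ?case using step.IH[OF n] step.hyps by (simp add: Suc_diff_le algebra_simps)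
qed

text \<open>A released unfinished job may wait for predecessors of its own task. The earliest
  unfinished job of that task has no such predecessor and was released no later, so it is
  ready.\<close>

lemma unfinished_imp_ready:
  assumes i: "i \<in> tasks S" and n: "enat n < num_jobs A i" and "release A i n \<le> t"
    and unf: "\<not> finished A \<sigma> i n t"
  obtains m where "ready S A \<sigma> i m t"
proof -
  define m where "m = (LEAST m. \<not> finished A \<sigma> i m t)"
  have m: "\<not> finished A \<sigma> i m t" "m \<le> n"
    unfolding m_def using unf by (fact LeastI, rule Least_le)
  have "\<forall>m'<m. finished A \<sigma> i m' t" unfolding m_def using not_less_Least by blast
  moreover have "enat m < num_jobs A i"
    using m(2) n by (meson enat_ord_simps(1) le_less_trans)
  moreover have "0 \<le> real (n - m) * period S i"
    using sys i by (simp add: sporadic_task_system_def less_imp_le)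
  then have "release A i m \<le> t"
    using release_separated[OF i n m(2)] assms(3) by linarith
  ultimately show ?thesis using that m(1) i unfolding ready_def by blast
qed

text \<open>If some job stayed unfinished, the jobs released in the window would receive strictly
  less service than they require in total, hence less than \<open>s\<close>. But they alone fill the
  busy window, which has measure \<open>s\<close>.\<close>

lemma busy_interval_clears:
  assumes H: "H \<subseteq> tasks S" and s: "s > 0" and a: "a \<ge> 0"
    and demand: "(\<Sum>i\<in>H. of_int \<lceil>s / period S i\<rceil> * wcet S i) \<le> s"
    and busy: "\<And>t. a < t \<Longrightarrow> t < a + s \<Longrightarrow> \<exists>i n. \<sigma> t = Some (i, n) \<and> i \<in> H"
    and clear: "\<And>i n. i \<in> H \<Longrightarrow> enat n < num_jobs A i \<Longrightarrow> release A i n < a \<Longrightarrow>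
                  finished A \<sigma> i n a"
    and j: "j \<in> H" and l: "enat l < num_jobs A j" "release A j l < a + s"
  shows "finished A \<sigma> j l (a + s)"
proof (rule ccontr)
  assume unf: "\<not> finished A \<sigma> j l (a + s)"
  define N where "N = (\<lambda>i. {n. enat n < num_jobs A i \<and> a \<le> release A i n \<and> release A i n < a + s})"
  define J where "J = Sigma H N"
  \<comment> \<open>The window is open on the left because the processor may be idle or run another
    task at \<open>a\<close> itself; the endpoint has measure zero.\<close>
  define R where "R = (\<lambda>p. {t \<in> {a<..<a + s}. \<sigma> t = Some p})"
  have finH: "finite H" using sys H finite_subset unfolding sporadic_task_system_def by blast
  have N: "finite (N i)" "real (card (N i)) \<le> of_int \<lceil>s / period S i\<rceil>" if "i \<in> H" for i
  proof -
    have i: "i \<in> tasks S" using that H by blast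
    have T: "0 < period S i" using i sys by (simp add: sporadic_task_system_def)
    have "release A i m + real (n - m) * period S i \<le> release A i n"
      if "m \<in> N i" "n \<in> N i" "m \<le> n" for m n
      using release_separated[OF i] that by (simp add: N_def)
    moreover have "a \<le> release A i n \<and> release A i n < a + s" if "n \<in> N i" for n
      using that by (simp add: N_def)
    ultimately show "finite (N i)" "real (card (N i)) \<le> of_int \<lceil>s / period S i\<rceil>"
      using separated_points_count[OF T _ _ s] by blast+
  qed
  have finJ: "finite J" unfolding J_def using finH N by (intro finite_SigmaI)
  have "\<not> finished A \<sigma> j l a" using unf finished_mono[of j l a "a + s"] s by auto
  then have jl: "(j, l) \<in> J"
    using clear[OF j l(1)] j l unfolding J_def N_def by force
  have cover: "{a<..<a + s} \<subseteq> (\<Union>p\<in>J. R p)"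
  proof
    fix t assume t: "t \<in> {a<..<a + s}"
    then obtain i n where in_: "\<sigma> t = Some (i, n)" "i \<in> H" using busy[of t] by auto
    from execD(1)[OF in_(1)] have r: "enat n < num_jobs A i" "release A i n \<le> t"
      "\<not> finished A \<sigma> i n t" by (auto simp: ready_def)
    \<comment> \<open>An executing job is unfinished at \<open>t\<close>, hence at \<open>a\<close>,
      so \<open>clear\<close> excludes a release before \<open>a\<close>: no earlier work is carried
      into the window.\<close>
    have "\<not> finished A \<sigma> i n a" using r(3) finished_mono[of i n a t] t by auto
    then have "a \<le> release A i n" using clear[OF in_(2) r(1)] by force
    then have "(i, n) \<in> J" using in_ r t by (auto simp: J_def N_def)
    then show "t \<in> (\<Union>p\<in>J. R p)" using t in_ by (auto simp: R_def)
  qed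
  have R: "R p \<in> lmeasurable" for p unfolding R_def by (intro lmeasurable_executing) simp
  have serv: "measure lebesgue (R (i, n)) \<le> service \<sigma> i n (a + s)" for i n
    unfolding service_def R_def using a
    by (intro measure_mono_fmeasurable lmeasurable_executing fmeasurableD) auto
  have "s = measure lebesgue {a<..<a + s}" using s by simp
  also have "\<dots> \<le> measure lebesgue (\<Union>p\<in>J. R p)"
    using cover R finJ by (intro measure_mono_fmeasurable fmeasurable.finite_UN) auto
  also have "\<dots> \<le> (\<Sum>p\<in>J. measure lebesgue (R p))"
    using finJ R by (intro measure_UNION_le) (auto intro: fmeasurableD)
  also have "\<dots> \<le> (\<Sum>(i, n)\<in>J. service \<sigma> i n (a + s))"
    using serv by (intro sum_mono) auto
  \<comment> \<open>Strictness comes from the unfinished job \<open>(j, l)\<close>, which lies in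
    \<open>J\<close>.\<close>
  also have "\<dots> < (\<Sum>(i, n)\<in>J. exec_time A i n)"
  proof (rule sum_strict_mono_ex1[OF finJ])
    show "\<forall>p\<in>J. (case p of (i, n) \<Rightarrow> service \<sigma> i n (a + s)) \<le> (case p of (i, n) \<Rightarrow> exec_time A i n)"
      using service_le_exec_time H by (auto simp: J_def N_def)
    show "\<exists>p\<in>J. (case p of (i, n) \<Rightarrow> service \<sigma> i n (a + s)) < (case p of (i, n) \<Rightarrow> exec_time A i n)"
      using jl unf by (force simp: finished_def)
  qed
  also have "\<dots> = (\<Sum>i\<in>H. \<Sum>n\<in>N i. exec_time A i n)"
    unfolding J_def using finH N by (subst sum.Sigma) auto
  also have "\<dots> \<le> (\<Sum>i\<in>H. real (card (N i)) * wcet S i)"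
    using legal H by (intro sum_mono sum_bounded_above) (auto simp: N_def legal_arrivals_def)
  also have "\<dots> \<le> (\<Sum>i\<in>H. of_int \<lceil>s / period S i\<rceil> * wcet S i)"
    using N H sys by (intro sum_mono mult_right_mono) (auto simp: sporadic_task_system_def less_imp_le)
  also have "\<dots> \<le> s" by (fact demand)
  finally show False by simp
qed

text \<open>Suppose the deadline is missed. From the last instant \<open>a\<close> up to the release
  with no pending work of \<open>H\<close>, such work is pending at all later times up to the
  deadline. Yet the busy window of length \<open>s\<close> after \<open>a\<close> ends by the
  deadline with all this work cleared.\<close>

lemma demand_met_imp_finished:
  assumes \<tau>: "\<tau> \<in> tasks S" and s: "0 < s" "s \<le> D"
    and demand: "(\<Sum>i\<in>{i \<in> tasks S. prio S \<tau> \<le> prio S i}.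
                    of_int \<lceil>s / period S i\<rceil> * wcet S i) \<le> s"
    and n: "enat n < num_jobs A \<tau>"
  shows "finished A \<sigma> \<tau> n (release A \<tau> n + D)"
proof (rule ccontr)
  assume unf: "\<not> ?thesis"
  define H where "H = {i \<in> tasks S. prio S \<tau> \<le> prio S i}"
  define r where "r = release A \<tau> n"
  define cleared where "cleared = (\<lambda>t. \<forall>i n. i \<in> H \<longrightarrow> enat n < num_jobs A i \<longrightarrow>
    release A i n < t \<longrightarrow> finished A \<sigma> i n t)"
  define B where "B = {t. 0 \<le> t \<and> t \<le> r \<and> cleared t}"
  define a where "a = Sup B"
  have H: "H \<subseteq> tasks S" "\<tau> \<in> H" using \<tau> by (auto simp: H_def)
  have rel: "0 \<le> release A i m" if "i \<in> H" "enat m < num_jobs A i" for i m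
    using legal that H by (auto simp: legal_arrivals_def)
  \<comment> \<open>No job is released before time 0, so the condition holds vacuously
    there.\<close>
  have "0 \<in> B"
    using rel \<tau> n H by (force simp: B_def r_def cleared_def)
  have bdd: "bdd_above B" unfolding B_def by (intro bdd_aboveI[of _ r]) auto
  have a: "0 \<le> a" "a \<le> r"
    unfolding a_def using \<open>0 \<in> B\<close> bdd by (auto intro: cSup_upper cSup_least simp: B_def)
  \<comment> \<open>The supremum is attained: a release strictly before \<open>a\<close> is also
    strictly before some \<open>t\<close> in \<open>B\<close>, and a job finished at
    \<open>t\<close> is still finished at \<open>a\<close>.\<close>
  have clear: "cleared a"
    unfolding cleared_def
  proof (intro allI impI)
    fix i m assume im: "i \<in> H" "enat m < num_jobs A i" "release A i m < a"
    then obtain t where t: "t \<in> B" "release A i m < t"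
      using less_cSup_iff[of B] \<open>0 \<in> B\<close> bdd unfolding a_def by blast
    then have "finished A \<sigma> i m t" using im unfolding B_def cleared_def by blast
    then show "finished A \<sigma> i m a"
      using finished_mono cSup_upper[OF t(1) bdd] unfolding a_def by blast
  qed
  \<comment> \<open>Up to \<open>r\<close> this is the maximality of \<open>a\<close>; after
    \<open>r\<close> the job that misses its deadline is itself pending.\<close>
  have pending: "\<exists>i m. i \<in> H \<and> enat m < num_jobs A i \<and> release A i m < t \<and> \<not> finished A \<sigma> i m t"
    if t: "a < t" "t \<le> r + D" for t
  proof (cases "t \<le> r")
    case True
    have "t \<notin> B" using cSup_upper[OF _ bdd, of t] t(1) unfolding a_def by linarith
    then have "\<not> cleared t" using True t a by (simp add: B_def)
    then show ?thesis unfolding cleared_def by blast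
  next
    case False
    have "\<not> finished A \<sigma> \<tau> n t" using unf finished_mono t(2) unfolding r_def by blast
    then show ?thesis using False H n unfolding r_def by force
  qed
  \<comment> \<open>Pending work of \<open>H\<close> yields a ready job of \<open>H\<close>; the
    executing job has at least its priority, and \<open>H\<close> is closed upwards in
    priority.\<close>
  have busy: "\<exists>i m. \<sigma> t = Some (i, m) \<and> i \<in> H" if t: "a < t" "t < a + s" for t
  proof -
    from t a s have "t \<le> r + D" by linarith
    then obtain i m where im: "i \<in> H" "enat m < num_jobs A i" "release A i m \<le> t"
        "\<not> finished A \<sigma> i m t"
      using pending t(1) less_imp_le by blast
    then obtain m' where "ready S A \<sigma> i m' t" using unfinished_imp_ready H by blast
    then obtain i' m'' where "\<sigma> t = Some (i', m'')" "ready S A \<sigma> i' m'' t" "prio S i \<le> prio S i'"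
      by (rule ready_imp_busy)
    then show ?thesis using im(1) by (auto simp: H_def ready_def)
  qed
  from a s have "a < a + s" "a + s \<le> r + D" by linarith+
  then obtain i m where im: "i \<in> H" "enat m < num_jobs A i" "release A i m < a + s"
      "\<not> finished A \<sigma> i m (a + s)"
    using pending by blast
  have "finished A \<sigma> i m (a + s)"
  proof (rule busy_interval_clears[OF H(1) s(1) a(1) _ busy _ im(1-3)])
    show "(\<Sum>i\<in>H. of_int \<lceil>s / period S i\<rceil> * wcet S i) \<le> s"
      using demand by (simp add: H_def)
  qed (use clear in \<open>auto simp: cleared_def\<close>)
  with im(4) show False by contradiction
qed

end

section \<open>Schedulability from a met demand and from the utilization bounds\<close>

lemma demand_met_imp_schedulable:
  assumes "sporadic_task_system S" "\<tau> \<in> tasks S" "0 < s" "s \<le> rel_deadline S \<tau>"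
    and "(\<Sum>i\<in>{i \<in> tasks S. prio S \<tau> \<le> prio S i}. of_int \<lceil>s / period S i\<rceil> * wcet S i) \<le> s"
  shows "schedulable S \<tau>"
  unfolding schedulable_def
proof (intro allI impI)
  fix A \<sigma> n
  assume "legal_arrivals S A" "fp_schedule S A \<sigma>" and n: "enat n < num_jobs A \<tau>"
  then interpret fp_run S A \<sigma> using assms(1) by unfold_locales
  show "finished A \<sigma> \<tau> n (release A \<tau> n + rel_deadline S \<tau>)"
    using demand_met_imp_finished assms(2-) n by blast
qed

theorem corollary2:
  fixes S :: "'a task_system" and \<tau> :: 'a and k :: nat
  assumes "sporadic_task_system S"
    and "\<tau> \<in> tasks S"
    and "wcet S \<tau> > 0"
    and "\<And>i. i \<in> tasks S \<Longrightarrow> i \<noteq> \<tau> \<Longrightarrow> prio S i \<noteq> prio S \<tau>"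
    and "\<And>i. i \<in> hp S \<tau> \<Longrightarrow> schedulable S i"
    and "k \<ge> 1"
    and "card (hp1 S \<tau>) = k - 1"
    and "(wcet' S \<tau> / rel_deadline S \<tau> + 1) * (\<Prod>j\<in>hp1 S \<tau>. utilization S j + 1) \<le> 2
       \<or> wcet' S \<tau> / rel_deadline S \<tau> + (\<Sum>j\<in>hp1 S \<tau>. utilization S j)
           \<le> real k * (2 powr (1 / real k) - 1)"
  shows "schedulable S \<tau>"
proof -
  define D where "D = rel_deadline S \<tau>"
  define G1 where "G1 = hp1 S \<tau>"
  define G2 where "G2 = hp2 S \<tau>"
  have params: "wcet S i > 0" "period S i > 0" "rel_deadline S i > 0" if "i \<in> tasks S" for i
    using assms(1) that by (auto simp: sporadic_task_system_def)
  have D: "D > 0" using params assms(2) by (simp add: D_def)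
  have sub: "G1 \<subseteq> tasks S" "G2 \<subseteq> tasks S" by (auto simp: G1_def G2_def hp1_def hp2_def hp_def)
  have "finite (tasks S)" using assms(1) by (simp add: sporadic_task_system_def)
  then have fin: "finite G1" "finite G2" using sub finite_subset by auto
  have "D / period S \<tau> > 0" using D params assms(2) by simp
  then have "\<lceil>D / period S \<tau>\<rceil> > 0" by simp
  then have c: "wcet' S \<tau> > 0"
    unfolding wcet'_def G2_def[symmetric] D_def[symmetric] using assms(3) params sub
    by (intro add_pos_nonneg mult_pos_pos sum_nonneg) (auto intro: less_imp_le[OF params(1)])
  have prod: "(wcet' S \<tau> / D + 1) * (\<Prod>j\<in>G1. wcet S j / period S j + 1) \<le> 2"
    using assms(8)
  proof
    assume "wcet' S \<tau> / rel_deadline S \<tau> + (\<Sum>j\<in>hp1 S \<tau>. utilization S j)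
        \<le> real k * (2 powr (1 / real k) - 1)"
    then show ?thesis
      using fin assms(6,7) c D params sub
      by (intro sum_bound_imp_product_bound[where k = k])
        (auto simp: G1_def D_def utilization_def less_imp_le subset_eq)
  qed (simp add: G1_def D_def utilization_def)
  obtain s where s: "0 < s" "s \<le> D"
      and demand: "wcet' S \<tau> + (\<Sum>i\<in>G1. of_int \<lceil>s / period S i\<rceil> * wcet S i) \<le> s"
    using product_bound_imp_demand_met[OF fin(1) c D _ _ prod] params sub
    by (auto simp: G1_def hp1_def D_def subset_eq)
  define d where "d = (\<lambda>i. of_int \<lceil>s / period S i\<rceil> * wcet S i)"
  \<comment> \<open>Since no other task shares the priority of \<open>\<tau>\<close>, the competing
    tasks are \<open>\<tau>\<close> and those of \<open>hp S \<tau>\<close>.\<close>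
  have split: "{i \<in> tasks S. prio S \<tau> \<le> prio S i} = insert \<tau> (G1 \<union> G2)"
    using assms(2) assms(4)[symmetric]
    by (auto simp: G1_def G2_def hp1_def hp2_def hp_def le_less)
  have "\<tau> \<notin> G1 \<union> G2" "G1 \<inter> G2 = {}" by (auto simp: G1_def G2_def hp1_def hp2_def hp_def)
  then have "(\<Sum>i\<in>{i \<in> tasks S. prio S \<tau> \<le> prio S i}. d i) = d \<tau> + sum d G2 + sum d G1"
    using fin by (simp add: split sum.union_disjoint)
  \<comment> \<open>\<open>wcet'\<close> covers the demand of \<open>\<tau>\<close> and
    \<open>hp2\<close> at every \<open>s \<le> D\<close>: the ceiling for \<open>\<tau>\<close> is
    monotone in \<open>s\<close>, and a period of at least \<open>D\<close> admits at most one
    job.\<close>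
  also have "\<dots> \<le> of_int \<lceil>D / period S \<tau>\<rceil> * wcet S \<tau> + (\<Sum>i\<in>G2. wcet S i) + sum d G1"
  proof (intro add_right_mono add_mono sum_mono)
    show "d \<tau> \<le> of_int \<lceil>D / period S \<tau>\<rceil> * wcet S \<tau>"
      unfolding d_def using s params[OF assms(2)]
      by (intro mult_right_mono) (auto intro!: ceiling_mono divide_right_mono)
  next
    fix i assume i: "i \<in> G2"
    then have "s \<le> period S i" using s by (simp add: G2_def hp2_def D_def)
    then have "\<lceil>s / period S i\<rceil> \<le> 1" using params[of i] i sub by (auto simp: ceiling_le_iff)
    then have "d i \<le> 1 * wcet S i"
      unfolding d_def using params(1)[of i] i sub by (intro mult_right_mono) auto
    then show "d i \<le> wcet S i" by simp
  qed
  also have "\<dots> \<le> s" using demand by (simp add: wcet'_def d_def D_def G2_def)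
  finally show ?thesis
    using demand_met_imp_schedulable[OF assms(1,2) s(1)] s(2) by (simp add: d_def D_def)
qed

end
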